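(* Let $G$ and $H$ be graphs with the same number of vertices such that $\delta(G)\ge 2$ and $\delta(H)\ge 1$. Let $M(G,H)$ denote a graph obtained from disjoint copies of $G$ and $H$ by adding a perfect matching between $V(G)$ and $V(H)$. Then $\mathcal{R}(M(G,H))$ has an isolated vertex.
   Context: All graphs are finite, simple and undirected; $N(v)$ denotes the open neighbourhood of $v$ and $\delta$ the minimum degree. A set $S\subseteq V(G)$ is a dominating set if every vertex of $G$ is in $S$ or adjacent to a vertex of $S$; it is a minimal dominating set if no proper subset of $S$ is a dominating set. The reconfiguration graph $\mathcal{R}(G)$ has as vertex set the collection of all minimal dominating sets of $G$, and two minimal dominating sets $M_1,M_2$ are adjacent iff there is a vertex $v$ with either ($M_2\setminus M_1=\{v\}$ and $M_1\setminus M_2\subseteq N(v)$) or ($M_1\setminus M_2=\{v\}$ and $M_2\setminus M_1\subseteq N(v)$). *)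

theory Defs
  imports "Graph_Theory.Pair_Digraph"
begin

text \<open>
  Finite simple undirected graphs are the symmetric, loop-free, finite digraphs of the
  locale \<^locale>\<open>pair_graph\<close>: an edge \<open>uv\<close> is present as both arcs \<open>(u, v)\<close> and \<open>(v, u)\<close>.
\<close>

definition nbhd :: "'a pair_pre_digraph \<Rightarrow> 'a \<Rightarrow> 'a set" where
  "nbhd G v = {w. (v, w) \<in> parcs G}"

text \<open>
  In a symmetric digraph the out-degree is the degree of the underlying undirected graph.
  For the graph without vertices the value is unspecified.
\<close>

definition min_degree :: "'a pair_pre_digraph \<Rightarrow> nat" where
  "min_degree G = Min (out_degree (with_proj G) ` pverts G)"

definition isolated_vertex :: "'a pair_pre_digraph \<Rightarrow> 'a \<Rightarrow> bool" where
  "isolated_vertex G v \<longleftrightarrow> v \<in> pverts G \<and> nbhd G v = {}"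

definition dominating_set :: "'a pair_pre_digraph \<Rightarrow> 'a set \<Rightarrow> bool" where
  "dominating_set G S \<longleftrightarrow> S \<subseteq> pverts G \<and> (\<forall>v\<in>pverts G. v \<in> S \<or> (\<exists>s\<in>S. v \<in> nbhd G s))"

definition minimal_dominating_set :: "'a pair_pre_digraph \<Rightarrow> 'a set \<Rightarrow> bool" where
  "minimal_dominating_set G S \<longleftrightarrow> dominating_set G S \<and> (\<forall>T. T \<subset> S \<longrightarrow> \<not> dominating_set G T)"

definition reconf_adj :: "'a pair_pre_digraph \<Rightarrow> 'a set \<Rightarrow> 'a set \<Rightarrow> bool" where
  "reconf_adj G M1 M2 \<longleftrightarrow>
     (\<exists>v\<in>pverts G. (M2 - M1 = {v} \<and> M1 - M2 \<subseteq> nbhd G v) \<or> (M1 - M2 = {v} \<and> M2 - M1 \<subseteq> nbhd G v))"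

definition reconf_graph :: "'a pair_pre_digraph \<Rightarrow> 'a set pair_pre_digraph" where
  "reconf_graph G =
     \<lparr> pverts = {M. minimal_dominating_set G M},
       parcs = {(M1, M2). minimal_dominating_set G M1 \<and> minimal_dominating_set G M2 \<and>
                  reconf_adj G M1 M2} \<rparr>"

definition perfect_matching_between :: "'a set \<Rightarrow> 'b set \<Rightarrow> ('a \<times> 'b) set \<Rightarrow> bool" where
  "perfect_matching_between A B P \<longleftrightarrow>
     P \<subseteq> A \<times> B \<and> (\<forall>a\<in>A. \<exists>!b. (a, b) \<in> P) \<and> (\<forall>b\<in>B. \<exists>!a. (a, b) \<in> P)"

text \<open>
  The disjoint copies of \<open>G\<close> and \<open>H\<close> are the two summands of the sum type; each pair
  \<open>(g, h) \<in> P\<close> adds the undirected edge between \<open>Inl g\<close> and \<open>Inr h\<close>.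
\<close>

definition matching_join ::
  "'a pair_pre_digraph \<Rightarrow> 'b pair_pre_digraph \<Rightarrow> ('a \<times> 'b) set \<Rightarrow> ('a + 'b) pair_pre_digraph" where
  "matching_join G H P =
     \<lparr> pverts = pverts G <+> pverts H,
       parcs = {(Inl u, Inl v) | u v. (u, v) \<in> parcs G} \<union> {(Inr u, Inr v) | u v. (u, v) \<in> parcs H} \<union>
         {(Inl g, Inr h) | g h. (g, h) \<in> P} \<union> {(Inr h, Inl g) | g h. (g, h) \<in> P} \<rparr>"

lemma pair_graphI:
  assumes "finite (pverts G)" "parcs G \<subseteq> pverts G \<times> pverts G" "sym (parcs G)" "irrefl (parcs G)"
  shows "pair_graph G"
proof unfold_locales
  show "finite (parcs G)"
    using assms(1,2) by (meson finite_SigmaI finite_subset)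
qed (use assms in \<open>auto simp: symmetric_def irrefl_def\<close>)

lemma pair_graph_reconf_graph:
  assumes "pair_graph G"
  shows "pair_graph (reconf_graph G)"
proof (rule pair_graphI)
  interpret pair_graph G by fact
  have "pverts (reconf_graph G) \<subseteq> Pow (pverts G)"
    by (auto simp: reconf_graph_def minimal_dominating_set_def dominating_set_def)
  then show "finite (pverts (reconf_graph G))"
    using pair_finite_verts finite_subset by blast
  show "sym (parcs (reconf_graph G))"
    by (rule symI) (auto simp: reconf_graph_def reconf_adj_def)
  show "irrefl (parcs (reconf_graph G))"
    by (auto simp: reconf_graph_def reconf_adj_def irrefl_def)
qed (auto simp: reconf_graph_def)

lemma pair_graph_matching_join:
  assumes "pair_graph G" "pair_graph H" "perfect_matching_between (pverts G) (pverts H) P"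
  shows "pair_graph (matching_join G H P)"
proof (rule pair_graphI)
  interpret G: pair_graph G by fact
  interpret H: pair_graph H by fact
  have P: "P \<subseteq> pverts G \<times> pverts H"
    using assms(3) by (auto simp: perfect_matching_between_def)
  show "finite (pverts (matching_join G H P))"
    using G.pair_finite_verts H.pair_finite_verts by (simp add: matching_join_def)
  show "parcs (matching_join G H P) \<subseteq> pverts (matching_join G H P) \<times> pverts (matching_join G H P)"
    using P by (auto simp: matching_join_def dest: G.wellformed' H.wellformed')
  have "sym (parcs G)" "sym (parcs H)"
    using G.pair_sym_arcs H.pair_sym_arcs by (simp_all add: symmetric_def)
  then show "sym (parcs (matching_join G H P))"
    by (auto simp: matching_join_def sym_def)
  show "irrefl (parcs (matching_join G H P))"
    using G.pair_no_loops H.pair_no_loops by (fastforce simp: matching_join_def irrefl_def)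
qed

end

theory Submission
  imports Defs
begin

text \<open>
  The isolated vertex is the copy of \<open>V(G)\<close>, in which the matching partner of every vertex is a
  private neighbour. A neighbour of it in the reconfiguration graph can only arise by exchanging some
  \<open>u\<close> for its partner \<open>v\<close>. Let \<open>v'\<close> be a neighbour of \<open>v\<close> in \<open>H\<close> and \<open>u'\<close> its partner. The exchange
  leaves \<open>u'\<close> without a private neighbour: \<open>v\<close> dominates \<open>v'\<close> and \<open>u\<close>, and \<open>u'\<close> has a neighbour in
  \<open>G\<close> other than \<open>u\<close>. So the new set is not minimal.
\<close>

lemma (in pair_wf_digraph) nbhd_subset_pverts: "nbhd G v \<subseteq> pverts G"
  by (auto simp: nbhd_def dest: wellformed')

lemma (in pair_loopfree_digraph) not_in_nbhd_self: "v \<notin> nbhd G v"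
  using pair_no_loops[of "(v, v)"] by (auto simp: nbhd_def)

lemma (in pair_sym_digraph) nbhd_commute: "v \<in> nbhd G u \<longleftrightarrow> u \<in> nbhd G v"
  by (auto simp: nbhd_def intro: arcs_symmetric)

lemma (in pair_fin_digraph) min_degree_le_card_nbhd:
  assumes "v \<in> pverts G"
  shows "min_degree G \<le> card (nbhd G v)"
proof -
  have "min_degree G \<le> out_degree (with_proj G) v"
    unfolding min_degree_def using assms pair_finite_verts by (intro Min_le) auto
  also have "out_arcs (with_proj G) v = Pair v ` nbhd G v"
    by (auto simp: out_arcs_def nbhd_def)
  then have "out_degree (with_proj G) v = card (nbhd G v)"
    by (simp add: out_degree_def card_image inj_on_def)
  finally show ?thesis .
qed

definition closed_nbhd :: "'a pair_pre_digraph \<Rightarrow> 'a \<Rightarrow> 'a set" where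
  "closed_nbhd G v = insert v (nbhd G v)"

definition private_nbhd :: "'a pair_pre_digraph \<Rightarrow> 'a set \<Rightarrow> 'a \<Rightarrow> 'a set" where
  "private_nbhd G S s = closed_nbhd G s - \<Union>(closed_nbhd G ` (S - {s}))"

lemma dominating_set_iff_closed_nbhd:
  "dominating_set G S \<longleftrightarrow> S \<subseteq> pverts G \<and> pverts G \<subseteq> \<Union>(closed_nbhd G ` S)"
  by (auto simp: dominating_set_def closed_nbhd_def)

lemma (in pair_wf_digraph) closed_nbhd_subset_pverts:
  "v \<in> pverts G \<Longrightarrow> closed_nbhd G v \<subseteq> pverts G"
  using nbhd_subset_pverts[of v] by (auto simp: closed_nbhd_def)

lemma (in pair_wf_digraph) minimal_dominating_set_iff_private_nbhd:
  "minimal_dominating_set G S \<longleftrightarrow> dominating_set G S \<and> (\<forall>s\<in>S. private_nbhd G S s \<noteq> {})"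
proof (intro iffI conjI ballI)
  assume min: "minimal_dominating_set G S"
  then show dom: "dominating_set G S"
    by (simp add: minimal_dominating_set_def)
  fix s assume s: "s \<in> S"
  then have "\<not> dominating_set G (S - {s})"
    using min by (auto simp: minimal_dominating_set_def)
  then have "\<not> \<Union>(closed_nbhd G ` S) \<subseteq> \<Union>(closed_nbhd G ` (S - {s}))"
    using dom by (auto simp: dominating_set_iff_closed_nbhd)
  then show "private_nbhd G S s \<noteq> {}"
    using s by (auto simp: private_nbhd_def)
next
  assume all_private: "dominating_set G S \<and> (\<forall>s\<in>S. private_nbhd G S s \<noteq> {})"
  have "\<not> dominating_set G T" if T: "T \<subset> S" for T
  proof
    assume "dominating_set G T"
    obtain s where s: "s \<in> S" "s \<notin> T"
      using T by blast
    then obtain v where v: "v \<in> private_nbhd G S s"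
      using all_private by blast
    have "v \<in> pverts G"
      using v s all_private closed_nbhd_subset_pverts[of s]
      by (auto simp: private_nbhd_def dominating_set_def)
    then obtain t where "t \<in> T" "v \<in> closed_nbhd G t"
      using \<open>dominating_set G T\<close> by (auto simp: dominating_set_iff_closed_nbhd)
    then show False
      using v s T by (auto simp: private_nbhd_def)
  qed
  then show "minimal_dominating_set G S"
    using all_private by (simp add: minimal_dominating_set_def)
qed

lemma minimal_dominating_set_Diff_nonempty:
  assumes "minimal_dominating_set G S" "minimal_dominating_set G T" "S \<noteq> T"
  shows "S - T \<noteq> {}"
  using assms by (auto simp: minimal_dominating_set_def)

text \<open>
  Up to isomorphism, the graphs with a perfect matching cut are the graphs \<open>M(G, H)\<close>; \<open>A\<close> is the copy
  of \<open>V(G)\<close>.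
\<close>

locale perfect_matching_cut = pair_bidirected_digraph G
  for G :: "'a pair_pre_digraph" +
  fixes A :: "'a set"
  assumes side_subset_pverts: "A \<subseteq> pverts G"
    and ex_nbhd_Diff_eq_singleton: "u \<in> A \<Longrightarrow> \<exists>v. nbhd G u - A = {v}"
    and ex_nbhd_Int_eq_singleton: "v \<in> pverts G - A \<Longrightarrow> \<exists>u. nbhd G v \<inter> A = {u}"
begin

lemma nbhd_Diff_eq_singleton:
  assumes "u \<in> A" "v \<in> nbhd G u - A"
  shows "nbhd G u - A = {v}"
  using ex_nbhd_Diff_eq_singleton[OF assms(1)] assms(2) by (metis singletonD)

lemma nbhd_Int_eq_singleton:
  assumes "v \<in> pverts G - A" "u \<in> nbhd G v \<inter> A"
  shows "nbhd G v \<inter> A = {u}"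
  using ex_nbhd_Int_eq_singleton[OF assms(1)] assms(2) by (metis singletonD)

lemma minimal_dominating_set_side: "minimal_dominating_set G A"
  unfolding minimal_dominating_set_iff_private_nbhd
proof (intro conjI ballI)
  have "v \<in> \<Union>(closed_nbhd G ` A)" if v: "v \<in> pverts G - A" for v
  proof -
    obtain u where "u \<in> nbhd G v \<inter> A"
      using ex_nbhd_Int_eq_singleton[OF v] by blast
    then show ?thesis
      using nbhd_commute[of u v] by (auto simp: closed_nbhd_def)
  qed
  then show "dominating_set G A"
    using side_subset_pverts by (auto simp: dominating_set_iff_closed_nbhd closed_nbhd_def)
next
  fix u assume u: "u \<in> A"
  then obtain v where v: "v \<in> nbhd G u - A"
    using ex_nbhd_Diff_eq_singleton by blast
  then have "nbhd G v \<inter> A = {u}"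
    using u nbhd_subset_pverts nbhd_commute[of u v] by (intro nbhd_Int_eq_singleton) auto
  then have "v \<in> private_nbhd G A u"
    using v nbhd_commute by (fastforce simp: private_nbhd_def closed_nbhd_def)
  then show "private_nbhd G A u \<noteq> {}"
    by blast
qed

lemma reconf_adj_side_DiffE:
  assumes M: "minimal_dominating_set G M" and adj: "reconf_adj G A M"
  obtains u v where "v \<in> nbhd G u" "A - M = {u}" "M - A = {v}"
proof -
  have "A \<noteq> M"
    using adj by (auto simp: reconf_adj_def)
  then have diff_nonempty: "A - M \<noteq> {}" "M - A \<noteq> {}"
    using M minimal_dominating_set_side by (metis minimal_dominating_set_Diff_nonempty)+
  consider (gain_one) v where "M - A = {v}" "A - M \<subseteq> nbhd G v"
    | (lose_one) u where "A - M = {u}" "M - A \<subseteq> nbhd G u"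
    using adj unfolding reconf_adj_def by blast
  then show thesis
  proof cases
    case gain_one
    then have "v \<in> pverts G - A"
      using M by (auto simp: minimal_dominating_set_def dominating_set_def)
    then obtain u where u: "nbhd G v \<inter> A = {u}"
      using ex_nbhd_Int_eq_singleton by blast
    have "A - M \<subseteq> nbhd G v \<inter> A"
      using gain_one by blast
    then have "A - M = {u}"
      using u diff_nonempty(1) by (simp add: subset_singleton_iff)
    moreover have "v \<in> nbhd G u"
      using u nbhd_commute[of u v] by auto
    ultimately show thesis
      using that gain_one(1) by blast
  next
    case lose_one
    then have "u \<in> A"
      by auto
    then obtain v where v: "nbhd G u - A = {v}"
      using ex_nbhd_Diff_eq_singleton by blast
    have "M - A \<subseteq> nbhd G u - A"
      using lose_one by blast
    then have "M - A = {v}"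
      using v diff_nonempty(2) by (simp add: subset_singleton_iff)
    moreover have "v \<in> nbhd G u"
      using v by auto
    ultimately show thesis
      using that lose_one(1) by blast
  qed
qed

lemma reconf_adj_sideE:
  assumes "minimal_dominating_set G M" "reconf_adj G A M"
  obtains u v where "v \<in> nbhd G u - A" "M = insert v (A - {u})"
proof -
  obtain u v where uv: "v \<in> nbhd G u" "A - M = {u}" "M - A = {v}"
    using assms by (rule reconf_adj_side_DiffE)
  have "M = (M - A) \<union> (A - (A - M))"
    by blast
  also have "\<dots> = insert v (A - {u})"
    unfolding uv by simp
  finally show thesis
    using that uv by auto
qed

lemma not_minimal_dominating_set_exchange:
  assumes card_nbhd: "\<And>w. w \<in> A \<Longrightarrow> 2 \<le> card (nbhd G w \<inter> A)"
    and nbhd_nonempty: "\<And>w. w \<in> pverts G - A \<Longrightarrow> nbhd G w - A \<noteq> {}"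
    and v: "v \<in> nbhd G u - A"
  shows "\<not> minimal_dominating_set G (insert v (A - {u}))" (is "\<not> minimal_dominating_set G ?M")
proof -
  obtain v' where v': "v' \<in> nbhd G v - A"
    using nbhd_nonempty[of v] v nbhd_subset_pverts by blast
  obtain u' where u': "u' \<in> nbhd G v' \<inter> A"
    using ex_nbhd_Int_eq_singleton[of v'] v' nbhd_subset_pverts by blast
  have v'_partner: "nbhd G u' - A = {v'}"
    using u' v' nbhd_commute[of u' v'] by (intro nbhd_Diff_eq_singleton) auto
  have "v' \<noteq> v"
    using v' not_in_nbhd_self by blast
  then have "u' \<noteq> u"
    using v v'_partner by auto
  have "\<not> nbhd G u' \<inter> A \<subseteq> {u}"
    using card_nbhd[of u'] u' card_mono[of "{u}" "nbhd G u' \<inter> A"] by auto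
  then obtain u'' where u'': "u'' \<in> nbhd G u' \<inter> A" "u'' \<noteq> u"
    by blast
  have "closed_nbhd G u' \<subseteq> \<Union>(closed_nbhd G ` (?M - {u'}))"
  proof
    fix x assume "x \<in> closed_nbhd G u'"
    then consider "x = u'" | "x = u" | "x = v'" | "x \<in> ?M - {u'}"
      using v'_partner not_in_nbhd_self by (auto simp: closed_nbhd_def)
    moreover have "u' \<in> closed_nbhd G u''" "u'' \<in> ?M - {u'}"
      using u'' nbhd_commute not_in_nbhd_self by (auto simp: closed_nbhd_def)
    moreover have "u \<in> closed_nbhd G v" "v' \<in> closed_nbhd G v" "v \<in> ?M - {u'}"
      using u' v v' nbhd_commute by (auto simp: closed_nbhd_def)
    ultimately show "x \<in> \<Union>(closed_nbhd G ` (?M - {u'}))"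
      by cases (auto simp: closed_nbhd_def)
  qed
  then have "private_nbhd G ?M u' = {}"
    by (auto simp: private_nbhd_def)
  then show ?thesis
    using u' \<open>u' \<noteq> u\<close> by (auto simp: minimal_dominating_set_iff_private_nbhd)
qed

theorem isolated_vertex_reconf_graph_side:
  assumes "\<And>u. u \<in> A \<Longrightarrow> 2 \<le> card (nbhd G u \<inter> A)"
    and "\<And>v. v \<in> pverts G - A \<Longrightarrow> nbhd G v - A \<noteq> {}"
  shows "isolated_vertex (reconf_graph G) A"
proof -
  have "\<not> reconf_adj G A M" if "minimal_dominating_set G M" for M
  proof
    assume "reconf_adj G A M"
    with that obtain u v where "v \<in> nbhd G u - A" "M = insert v (A - {u})"
      by (rule reconf_adj_sideE)
    with that show False
      using not_minimal_dominating_set_exchange[OF assms] by auto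
  qed
  then show ?thesis
    using minimal_dominating_set_side by (auto simp: isolated_vertex_def nbhd_def reconf_graph_def)
qed

end

lemma perfect_matching_between_Image_eq_singleton:
  assumes "perfect_matching_between A B P"
  shows "a \<in> A \<Longrightarrow> \<exists>b. P `` {a} = {b}" and "b \<in> B \<Longrightarrow> \<exists>a. P\<inverse> `` {b} = {a}"
  using assms by (simp_all add: perfect_matching_between_def Image_singleton Nitpick.Ex1_unfold)

lemma nbhd_matching_join_Inl:
  "nbhd (matching_join G H P) (Inl g) = Inl ` nbhd G g \<union> Inr ` (P `` {g})"
  by (auto simp: nbhd_def matching_join_def)

lemma nbhd_matching_join_Inr:
  "nbhd (matching_join G H P) (Inr h) = Inr ` nbhd H h \<union> Inl ` (P\<inverse> `` {h})"
  by (auto simp: nbhd_def matching_join_def)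

lemma (in pair_fin_digraph) min_degree_le_card_nbhd_matching_join_Inl:
  assumes "g \<in> pverts G"
  shows "min_degree G \<le> card (nbhd (matching_join G H P) (Inl g) \<inter> Inl ` pverts G)"
proof -
  have "nbhd (matching_join G H P) (Inl g) \<inter> Inl ` pverts G = Inl ` nbhd G g"
    using nbhd_subset_pverts by (auto simp: nbhd_matching_join_Inl)
  then show ?thesis
    using min_degree_le_card_nbhd[OF assms] by (simp add: card_image)
qed

lemma pverts_matching_join: "pverts (matching_join G H P) = pverts G <+> pverts H"
  by (simp add: matching_join_def)

lemma perfect_matching_cut_matching_join:
  fixes G :: "'a pair_pre_digraph" and H :: "'b pair_pre_digraph"
  assumes "pair_graph G" "pair_graph H" "perfect_matching_between (pverts G) (pverts H) P"
  shows "perfect_matching_cut (matching_join G H P) (Inl ` pverts G)"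
proof -
  interpret G: pair_graph G by fact
  interpret J: pair_graph "matching_join G H P"
    using assms by (rule pair_graph_matching_join)
  let ?J = "matching_join G H P" and ?A = "Inl ` pverts G :: ('a + 'b) set"
  note matching = perfect_matching_between_Image_eq_singleton[OF assms(3)]
  show ?thesis
  proof unfold_locales
    show "?A \<subseteq> pverts ?J"
      by (auto simp: pverts_matching_join)
  next
    fix u assume "u \<in> ?A"
    then obtain g where g: "u = Inl g" "g \<in> pverts G"
      by blast
    then have "nbhd ?J u - ?A = Inr ` (P `` {g})"
      using G.nbhd_subset_pverts by (auto simp: nbhd_matching_join_Inl)
    then show "\<exists>v. nbhd ?J u - ?A = {v}"
      using matching(1)[OF g(2)] by auto
  next
    fix v assume "v \<in> pverts ?J - ?A"
    then obtain h where h: "v = Inr h" "h \<in> pverts H"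
      by (auto simp: pverts_matching_join)
    then have "nbhd ?J v \<inter> ?A = Inl ` (P\<inverse> `` {h})"
      using assms(3) by (auto simp: nbhd_matching_join_Inr perfect_matching_between_def)
    then show "\<exists>u. nbhd ?J v \<inter> ?A = {u}"
      using matching(2)[OF h(2)] by auto
  qed
qed

theorem theorem13:
  fixes G :: "'a pair_pre_digraph" and H :: "'b pair_pre_digraph" and P :: "('a \<times> 'b) set"
  assumes "pair_graph G" and "pair_graph H"
    and "card (pverts G) = card (pverts H)"
    and "min_degree G \<ge> 2" and "min_degree H \<ge> 1"
    and "perfect_matching_between (pverts G) (pverts H) P"
  shows "\<exists>M. isolated_vertex (reconf_graph (matching_join G H P)) M"
proof
  let ?J = "matching_join G H P" and ?A = "Inl ` pverts G :: ('a + 'b) set"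
  interpret G: pair_graph G by fact
  interpret H: pair_graph H by fact
  interpret perfect_matching_cut ?J ?A
    using assms(1,2,6) by (rule perfect_matching_cut_matching_join)
  have "2 \<le> card (nbhd ?J u \<inter> ?A)" if "u \<in> ?A" for u
    using that assms(4) G.min_degree_le_card_nbhd_matching_join_Inl le_trans by blast
  moreover have "nbhd ?J v - ?A \<noteq> {}" if v: "v \<in> pverts ?J - ?A" for v
  proof -
    obtain h where h: "v = Inr h" "h \<in> pverts H"
      using v by (auto simp: pverts_matching_join)
    then have "nbhd H h \<noteq> {}"
      using assms(5) H.min_degree_le_card_nbhd[of h] by auto
    then show ?thesis
      using h by (auto simp: nbhd_matching_join_Inr)
  qed
  ultimately show "isolated_vertex (reconf_graph ?J) ?A"
    by (rule isolated_vertex_reconf_graph_side)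
qed

end
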